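(* There is a bounded Talagrand integrable function $\phi:[0,1]\to\ell^\infty(\mathbb N)$ which is not McShane integrable.
   Context: $\ell^\infty(\mathbb N)$ is the Banach space of bounded real sequences with the supremum norm. $\mu$ is Lebesgue measure on $[0,1]$. Let $X$ be a Banach space. Intervals are non-overlapping if their interiors are pairwise disjoint. McShane integral: A McShane partition of $[0,1]$ is a finite sequence $\langle([a_i,b_i],t_i)\rangle_{i\le n}$ such that $\langle[a_i,b_i]\rangle_{i\le n}$ is a non-overlapping family of closed intervals covering $[0,1]$ (i.e. with union $[0,1]$) and $t_i\in[0,1]$ for each $i$ (it is not required that $t_i\in[a_i,b_i]$). A gauge on $[0,1]$ is a function $\delta:[0,1]\to(0,\infty)$. The partition is subordinate to $\delta$ if $t_i-\delta(t_i)\le a_i\le b_i\le t_i+\delta(t_i)$ for every $i\le n$. A function $\phi:[0,1]\to X$ is McShane integrable, with McShane integral $w\in X$, if for every $\epsilon>0$ there is a gauge $\delta$ such that $\|w-\sum_{i\le n}(b_i-a_i)\phi(t_i)\|\le\epsilon$ for every McShane partition $\langle([a_i,b_i],t_i)\rangle_{i\le n}$ of $[0,1]$ subordinate to $\delta$. Talagrand integral: $\phi:[0,1]\to X$ is Talagrand integrable, with Talagrand integral $w\in X$, if $w=\lim_{n\to\infty}\frac1n\sum_{i<n}\phi(s_i)$ (norm limit) for almost all sequences $\langle s_i\rangle_{i\in\mathbb N}\in[0,1]^{\mathbb N}$, where $[0,1]^{\mathbb N}$ is given the product probability measure of copies of $\mu$. *)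

theory Defs
  imports "HOL-Probability.Probability"
begin

text \<open>
  Functions on the unit interval are rendered as total functions on the reals; the notions below
  only inspect their values on \<open>{0..1}\<close>.

  The space of bounded real sequences with the supremum norm is the library's type
  \<open>nat \<Rightarrow>\<^sub>C real\<close> of bounded continuous functions: continuity is vacuous because \<open>nat\<close> carries
  the discrete topology, as the next two facts confirm.
\<close>

lemma range_apply_bcontfun_nat:
  "range (apply_bcontfun :: (nat \<Rightarrow>\<^sub>C real) \<Rightarrow> nat \<Rightarrow> real) = {x. bounded (range x)}"
proof -
  have "range (apply_bcontfun :: (nat \<Rightarrow>\<^sub>C real) \<Rightarrow> nat \<Rightarrow> real) = bcontfun"
    using type_definition.Rep_range[OF type_definition_bcontfun] .
  also have "\<dots> = {x. bounded (range x)}"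
    by (auto simp: bcontfun_def)
  finally show ?thesis .
qed

lemma norm_bcontfun_nat:
  fixes x :: "nat \<Rightarrow>\<^sub>C real"
  shows "norm x = (SUP k. \<bar>apply_bcontfun x k\<bar>)"
  by (simp add: norm_bcontfun_def dist_bcontfun_def)

text \<open>
  The library proves completeness of \<open>'a \<Rightarrow>\<^sub>C 'b\<close> only for a metric domain type, and \<open>nat\<close> is not
  an instance of \<^class>\<open>metric_space\<close>; completeness holds for every topological domain.
\<close>

instance bcontfun :: (topological_space, complete_space) complete_space
proof
  fix X :: "nat \<Rightarrow> ('a \<Rightarrow>\<^sub>C 'b)"
  assume X: "Cauchy X"
  have "uniformly_Cauchy_on UNIV (\<lambda>n. apply_bcontfun (X n))"
    by (rule uniformly_Cauchy_onI) (meson X[unfolded Cauchy_def] dist_fun_lt_imp_dist_val_lt)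
  then obtain g where "uniform_limit UNIV (\<lambda>n. apply_bcontfun (X n)) g sequentially"
    by (blast dest: Cauchy_uniformly_convergent[unfolded uniformly_convergent_on_def])
  then obtain l where "X \<longlonglongrightarrow> l"
    by (rule uniform_limit_bcontfunE[OF _ sequentially_bot])
  then show "convergent X"
    by (rule convergentI)
qed

instance bcontfun :: (topological_space, banach) banach ..

text \<open>
  The intervals form an indexed family, so disjointness of interiors is required for distinct
  indices. Degenerate intervals are allowed, and a tag need not lie in its interval.
\<close>

definition mcshane_partition ::
    "nat \<Rightarrow> (nat \<Rightarrow> real) \<Rightarrow> (nat \<Rightarrow> real) \<Rightarrow> (nat \<Rightarrow> real) \<Rightarrow> bool" where
  "mcshane_partition n a b t \<longleftrightarrow>
     (\<forall>i<n. a i \<le> b i) \<and>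
     disjoint_family_on (\<lambda>i. interior {a i..b i}) {..<n} \<and>
     (\<Union>i<n. {a i..b i}) = {0..1} \<and>
     (\<forall>i<n. t i \<in> {0..1})"

definition subordinate ::
    "(real \<Rightarrow> real) \<Rightarrow> nat \<Rightarrow> (nat \<Rightarrow> real) \<Rightarrow> (nat \<Rightarrow> real) \<Rightarrow> (nat \<Rightarrow> real) \<Rightarrow> bool" where
  "subordinate \<delta> n a b t \<longleftrightarrow>
     (\<forall>i<n. t i - \<delta> (t i) \<le> a i \<and> a i \<le> b i \<and> b i \<le> t i + \<delta> (t i))"

definition has_mcshane_integral :: "(real \<Rightarrow> 'a::banach) \<Rightarrow> 'a \<Rightarrow> bool" where
  "has_mcshane_integral \<phi> w \<longleftrightarrow>
     (\<forall>\<epsilon>>0. \<exists>\<delta>::real \<Rightarrow> real. (\<forall>x\<in>{0..1}. \<delta> x > 0) \<and>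
        (\<forall>n a b t. mcshane_partition n a b t \<and> subordinate \<delta> n a b t \<longrightarrow>
           norm (w - (\<Sum>i<n. (b i - a i) *\<^sub>R \<phi> (t i))) \<le> \<epsilon>))"

definition mcshane_integrable :: "(real \<Rightarrow> 'a::banach) \<Rightarrow> bool" where
  "mcshane_integrable \<phi> \<longleftrightarrow> (\<exists>w. has_mcshane_integral \<phi> w)"

text \<open>
  The set of sequences at which the averages converge need not be measurable; \<open>AE\<close> only asks its
  complement to be contained in a null set, so passing to the completed product changes nothing.
\<close>

definition has_talagrand_integral :: "(real \<Rightarrow> 'a::banach) \<Rightarrow> 'a \<Rightarrow> bool" where
  "has_talagrand_integral \<phi> w \<longleftrightarrow>
     (AE s in (\<Pi>\<^sub>M i\<in>(UNIV::nat set). lebesgue_on {0..1}).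
        (\<lambda>n. (1 / real n) *\<^sub>R (\<Sum>i<n. \<phi> (s i))) \<longlonglongrightarrow> w)"

definition talagrand_integrable :: "(real \<Rightarrow> 'a::banach) \<Rightarrow> bool" where
  "talagrand_integrable \<phi> \<longleftrightarrow> (\<exists>w. has_talagrand_integral \<phi> w)"

end

theory Submission
  imports Defs
begin

text \<open>
  Cut the unit interval into \<open>2\<^sup>n\<close> blocks and each block into \<open>2\<^sup>n\<close> cells. For \<open>r < 2\<^sup>n\<close> the comb of
  level \<open>n\<close> with offset \<open>r\<close> is the union of the \<open>r\<close>-th cells of all the blocks; its measure is
  \<open>2\<^sup>-\<^sup>n\<close>. The coordinates of the function are the indicators of all combs of all levels.

  It is Talagrand integrable because the law of large numbers holds uniformly over the combs: a
  sample of size \<open>N\<close> visits one of the \<open>2\<^sup>n\<close> combs of level \<open>n\<close> at least \<open>N / q\<close> times with probability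
  at most \<open>2\<^sup>n 2\<^sup>N 2 powr (- n N / q)\<close>, which is summable over \<open>n, N \<ge> 4 q\<close>, and the remaining
  finitely many combs are covered by Hoeffding's inequality.

  It is not McShane integrable, not even Henstock-Kurzweil integrable. The points at which a gauge
  allows blocks of level \<open>n\<close> have outer measure close to 1 for large \<open>n\<close>, so they meet most of the
  cells, and by averaging they meet some comb in most of the blocks. Tagging these blocks there
  gives a sum close to 1 in the coordinate of that comb, whose integral is \<open>2\<^sup>-\<^sup>n\<close>.
\<close>


section \<open>Laws of large numbers, pointwise and uniform over rare sets\<close>

text \<open>The joint map of all coordinates is the identity of the product space, so independence
  reduces to every coordinate having law \<open>M\<close>.\<close>

lemma prod_space_indep_coordinates:
  assumes "prob_space M"
  shows "prob_space.indep_vars (Pi\<^sub>M (UNIV::'i set) (\<lambda>_. M)) (\<lambda>_. M) (\<lambda>i s. s i) UNIV"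
proof -
  interpret M: prob_space M by fact
  interpret P: product_prob_space "\<lambda>_. M" "UNIV::'i set" ..
  have "distr (Pi\<^sub>M UNIV (\<lambda>_. M)) M (\<lambda>s. s i) = M" for i :: 'i
    using P.PiM_component[of i] by simp
  then show ?thesis
    by (subst P.P.indep_vars_iff_distr_eq_PiM') (simp_all add: restrict_UNIV)
qed

text \<open>Hoeffding's inequality bounds the probability of a deviation of at least
  \<open>e\<close> by a geometric sequence in \<open>N\<close>, so Borel-Cantelli applies for each
  fixed \<open>e\<close>.\<close>

lemma AE_average_tendsto_expectation:
  fixes f :: "'a \<Rightarrow> real"
  assumes "prob_space M" and f [measurable]: "f \<in> borel_measurable M"
    and ab: "\<And>x. f x \<in> {a..b}" "a < b"
  shows "AE s in (\<Pi>\<^sub>M i\<in>(UNIV::nat set). M).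
    (\<lambda>N. (\<Sum>i<N. f (s i)) / real N) \<longlonglongrightarrow> (\<integral>x. f x \<partial>M)"
proof -
  interpret M: prob_space M by fact
  interpret P: product_prob_space "\<lambda>_. M" "UNIV::nat set" ..
  let ?P = "\<Pi>\<^sub>M i\<in>(UNIV::nat set). M"
  let ?\<mu> = "\<integral>x. f x \<partial>M"
  have indep: "P.P.indep_vars (\<lambda>_. borel) (\<lambda>i s. f (s i)) UNIV"
    using P.P.indep_vars_compose2[OF prod_space_indep_coordinates[OF assms(1)], of "\<lambda>_. f" "\<lambda>_. borel"]
    by simp
  have distr: "distr ?P borel (\<lambda>s. f (s i)) = distr M borel f" for i
  proof -
    have "distr (distr ?P M (\<lambda>s. s i)) borel f = distr ?P borel (f \<circ> (\<lambda>s. s i))"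
      by (rule distr_distr) auto
    with P.PiM_component[of i] show ?thesis by (simp add: o_def)
  qed
  have mean: "P.P.expectation (\<lambda>s. f (s 0)) = ?\<mu>"
  proof -
    have "P.P.expectation (\<lambda>s. f (s 0)) = (\<integral>x. x \<partial>distr ?P borel (\<lambda>s. f (s 0)))"
      by (simp add: integral_distr)
    also have "\<dots> = ?\<mu>"
      unfolding distr by (simp add: integral_distr)
    finally show ?thesis .
  qed
  define A where "A e N = {s \<in> space ?P. e \<le> \<bar>(\<Sum>i<N. f (s i)) / real N - ?\<mu>\<bar>}" for e N
  have A [measurable]: "A e N \<in> sets ?P" for e N
    unfolding A_def by measurable
  have bound: "measure ?P (A e N) \<le> 2 * exp (- 2 * e\<^sup>2 / (b - a)\<^sup>2) ^ N" if "e > 0" "N > 0" for e N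
  proof -
    interpret H: Hoeffding_ineq_iid ?P "{..<N}" "\<lambda>i s. f (s i)" "\<lambda>s. f (s 0)" a b
      "P.P.expectation (\<lambda>s. f (s 0))"
      by unfold_locales (use ab P.P.indep_vars_subset[OF indep] in \<open>auto simp: distr\<close>)
    have "measure ?P (A e N) \<le> 2 * exp (- 2 * real N * e\<^sup>2 / (b - a)\<^sup>2)"
      using H.Hoeffding_ineq_abs_ge'[of e] that ab unfolding A_def mean
      by (simp add: lessThan_empty_iff)
    also have "exp (- 2 * real N * e\<^sup>2 / (b - a)\<^sup>2) = exp (- 2 * e\<^sup>2 / (b - a)\<^sup>2) ^ N"
      by (simp flip: exp_of_nat_mult add: algebra_simps)
    finally show ?thesis .
  qed
  have "AE s in ?P. \<forall>\<^sub>F N in sequentially. s \<in> space ?P - A e N" if "e > 0" for e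
  proof (rule borel_cantelli_AE1[OF A])
    have "- 2 * e\<^sup>2 / (b - a)\<^sup>2 < 0" using that ab by (simp add: divide_less_0_iff)
    then have "summable (\<lambda>N. 2 * exp (- 2 * e\<^sup>2 / (b - a)\<^sup>2) ^ N)"
      by (intro summable_mult summable_geometric) simp
    then show "summable (\<lambda>N. measure ?P (A e N))"
      by (rule summable_comparison_test'[where N = 1]) (use bound that in auto)
  qed (simp add: less_top[symmetric])
  \<comment> \<open>Only countably many thresholds are considered, so that the exceptional null sets
    can be united.\<close>
  then have "AE s in ?P. \<forall>q. \<forall>\<^sub>F N in sequentially. s \<in> space ?P - A (1 / real (Suc q)) N"
    by (subst AE_all_countable) simp
  then show ?thesis
  proof eventually_elim
    case (elim s)
    show ?case
    proof (rule tendstoI)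
      fix e :: real assume "e > 0"
      then obtain q where q: "1 / real (Suc q) < e"
        using nat_approx_posE by blast
      from elim have "\<forall>\<^sub>F N in sequentially. s \<in> space ?P - A (1 / real (Suc q)) N" ..
      then show "\<forall>\<^sub>F N in sequentially. dist ((\<Sum>i<N. f (s i)) / real N) ?\<mu> < e"
        by eventually_elim (use q in \<open>auto simp: A_def dist_real_def\<close>)
    qed
  qed
qed

text \<open>Union bound over the sets \<open>J\<close> of at least \<open>N / q\<close> visiting
  times: there are at most \<open>2 ^ N\<close> of them, and by independence each has probability at
  most \<open>(1/2) ^ (n * card J)\<close>. The exponent \<open>2 * n + 2 * N\<close> is chosen to
  absorb the factor \<open>2 ^ N\<close> here and the number \<open>2 ^ n\<close> of combs later,
  leaving \<open>(1/2) ^ (n + N)\<close>.\<close>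

lemma prob_frequent_visits_le:
  fixes q n N :: nat
  assumes "prob_space M" and A [measurable]: "A \<in> sets M" and small: "measure M A \<le> (1/2) ^ n"
    and q: "0 < q" "4 * q \<le> n" "4 * q \<le> N"
  shows "measure (\<Pi>\<^sub>M i\<in>(UNIV::nat set). M)
    {s \<in> space (\<Pi>\<^sub>M i\<in>(UNIV::nat set). M). real N \<le> real q * (\<Sum>i<N. indicator A (s i))}
      \<le> 2 ^ N * (1/2) ^ (2 * n + 2 * N)" (is "measure ?P ?S \<le> _")
proof -
  interpret M: prob_space M by fact
  interpret P: product_prob_space "\<lambda>_. M" "UNIV::nat set" ..
  let ?C = "\<lambda>J. {s \<in> space ?P. \<forall>i\<in>J. s i \<in> A}"
  let ?F = "{J. J \<subseteq> {..<N} \<and> N \<le> q * card J}"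
  have fin: "finite ?F" "\<And>J. J \<in> ?F \<Longrightarrow> finite J"
    by (auto intro: finite_subset[of _ "Pow {..<N}"] finite_subset[of _ "{..<N}"])
  have C [measurable]: "?C J \<in> sets ?P" if "finite J" for J
    using that by measurable
  have prob_C: "measure ?P (?C J) \<le> (1/2) ^ (2 * n + 2 * N)" if J: "J \<in> ?F" for J
  proof -
    have "measure ?P (?C J) = measure M A ^ card J"
      using P.emeasure_PiM_Collect[of J "\<lambda>_. A"] fin(2)[OF J]
      by (simp add: P.P.emeasure_eq_measure M.emeasure_eq_measure ennreal_power measure_nonneg)
    also have "\<dots> \<le> ((1/2) ^ n) ^ card J"
      using small by (intro power_mono) auto
    also have "\<dots> = (1/2) ^ (n * card J)"
      by (simp add: power_mult)
    also have "\<dots> \<le> (1/2) ^ (2 * n + 2 * N)"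
    proof (rule power_decreasing)
      \<comment> \<open>After multiplication by \<open>q\<close>, half the sum of the two bounds
        \<open>4 * q * n\<close> and \<open>4 * q * N\<close> for \<open>n * N\<close> is the
        required one.\<close>
      have "n * N \<le> n * (q * card J)" using J by simp
      moreover have "4 * q * n \<le> N * n" "4 * q * N \<le> n * N" using q by simp_all
      ultimately have "q * (2 * n + 2 * N) \<le> q * (n * card J)"
        by (simp only: distrib_left mult_ac)
      then show "2 * n + 2 * N \<le> n * card J" using q by simp
    qed auto
    finally show ?thesis .
  qed
  \<comment> \<open>The witness for a sample is the set of all its visiting times before
    \<open>N\<close>.\<close>
  have "?S \<subseteq> (\<Union>J\<in>?F. ?C J)"
  proof
    fix s assume s: "s \<in> ?S"
    have "(\<Sum>i<N. indicator A (s i)) = real (card {i\<in>{..<N}. s i \<in> A})"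
      by (simp add: indicator_def sum.If_cases Int_def)
    with s have "real N \<le> real (q * card {i\<in>{..<N}. s i \<in> A})"
      by simp
    then have "N \<le> q * card {i\<in>{..<N}. s i \<in> A}"
      by (simp only: of_nat_le_iff)
    moreover have "{i\<in>{..<N}. s i \<in> A} \<subseteq> {..<N}"
      by blast
    ultimately have "{i\<in>{..<N}. s i \<in> A} \<in> ?F"
      by (simp only: mem_Collect_eq simp_thms)
    moreover have "s \<in> ?C {i\<in>{..<N}. s i \<in> A}"
      using s by simp
    ultimately show "s \<in> (\<Union>J\<in>?F. ?C J)"
      by (rule UN_I)
  qed
  then have "measure ?P ?S \<le> measure ?P (\<Union>J\<in>?F. ?C J)"
    by (rule P.P.finite_measure_mono) (intro sets.finite_UN C fin)
  also have "\<dots> \<le> (\<Sum>J\<in>?F. measure ?P (?C J))"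
    by (rule measure_UNION_le) (intro C fin)+
  also have "\<dots> \<le> (\<Sum>J\<in>?F. (1/2) ^ (2 * n + 2 * N))"
    by (intro sum_mono prob_C)
  also have "\<dots> = real (card ?F) * (1/2) ^ (2 * n + 2 * N)"
    by simp
  also have "\<dots> \<le> 2 ^ N * (1/2) ^ (2 * n + 2 * N)"
  proof (rule mult_right_mono)
    have "card ?F \<le> card (Pow {..<N})" by (intro card_mono) auto
    then have "real (card ?F) \<le> real (2 ^ N)"
      unfolding card_Pow[OF finite_lessThan] card_lessThan of_nat_le_iff .
    then show "real (card ?F) \<le> 2 ^ N" by simp
  qed simp
  finally show ?thesis .
qed

text \<open>The bounds on frequent visits are summable over the offsets, over the levels from
  \<open>4 * q\<close> on and over \<open>N\<close> together. All levels can therefore be put into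
  one bad event per \<open>N\<close> before Borel-Cantelli is used, which makes the threshold for
  \<open>N\<close> independent of \<open>n\<close> and \<open>r\<close>.\<close>

lemma AE_eventually_rare_uniformly:
  fixes A :: "nat \<Rightarrow> nat \<Rightarrow> 'a set"
  assumes "prob_space M" and A [measurable]: "\<And>n r. A n r \<in> sets M"
    and small: "\<And>n r. measure M (A n r) \<le> (1/2) ^ n" and q: "0 < q"
  shows "AE s in (\<Pi>\<^sub>M i\<in>(UNIV::nat set). M). \<forall>\<^sub>F N in sequentially.
    \<forall>n\<ge>4 * q. \<forall>r<2 ^ n. real q * (\<Sum>i<N. indicator (A n r) (s i)) < real N"
proof -
  interpret M: prob_space M by fact
  interpret P: product_prob_space "\<lambda>_. M" "UNIV::nat set" ..
  let ?P = "\<Pi>\<^sub>M i\<in>(UNIV::nat set). M"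
  define S where "S N n r = {s \<in> space ?P. real N \<le> real q * (\<Sum>i<N. indicator (A n r) (s i))}"
    for N n r
  define B where "B N n = (\<Union>r<2 ^ n. S N n r)" for N n
  define F where "F N = (\<Union>n. B N (4 * q + n))" for N
  have S [measurable]: "S N n r \<in> sets ?P" for N n r
    unfolding S_def by measurable
  have B [measurable]: "B N n \<in> sets ?P" for N n
    unfolding B_def by measurable
  have F [measurable]: "F N \<in> sets ?P" for N
    unfolding F_def by measurable
  have prob_B: "measure ?P (B N n) \<le> (1/2) ^ (n + N)" if "4 * q \<le> n" "4 * q \<le> N" for N n
  proof -
    have "measure ?P (B N n) \<le> (\<Sum>r<2 ^ n. measure ?P (S N n r))"
      unfolding B_def by (rule measure_UNION_le) auto
    also have "\<dots> \<le> (\<Sum>r<(2::nat) ^ n. 2 ^ N * (1/2) ^ (2 * n + 2 * N))"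
      unfolding S_def by (intro sum_mono prob_frequent_visits_le assms that)
    also have "\<dots> = (1/2) ^ (n + N)"
      by (simp add: power_add power_mult power2_eq_square field_simps)
    finally show ?thesis .
  qed
  have prob_F: "measure ?P (F N) \<le> 2 * (1/2) ^ N" if "4 * q \<le> N" for N
  proof -
    have sums: "(\<lambda>n. (1/2) ^ n * (1/2) ^ (4 * q + N)) sums (2 * (1/2::real) ^ (4 * q + N))"
      using sums_mult2[OF geometric_sums[of "1/2::real"]] by simp
    have le: "measure ?P (B N (4 * q + n)) \<le> (1/2) ^ n * (1/2) ^ (4 * q + N)" for n
      using prob_B[of "4 * q + n" N] that by (simp add: power_add mult_ac)
    have summable: "summable (\<lambda>n. measure ?P (B N (4 * q + n)))"
      by (rule summable_comparison_test'[OF sums_summable[OF sums], where N = 0]) (use le in auto)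
    have "measure ?P (F N) \<le> (\<Sum>n. measure ?P (B N (4 * q + n)))"
      unfolding F_def by (rule P.P.finite_measure_subadditive_countably) (use summable in auto)
    also have "\<dots> \<le> 2 * (1/2::real) ^ (4 * q + N)"
      using suminf_le[OF le summable sums_summable[OF sums]] sums_unique[OF sums] by simp
    also have "\<dots> \<le> 2 * (1/2) ^ N"
      by (simp add: power_decreasing)
    finally show ?thesis .
  qed
  have "AE s in ?P. \<forall>\<^sub>F N in sequentially. s \<in> space ?P - F N"
  proof (rule borel_cantelli_AE1[OF F])
    have "summable (\<lambda>N. 2 * (1/2::real) ^ N)"
      by (intro summable_mult summable_geometric) simp
    then show "summable (\<lambda>N. measure ?P (F N))"
      by (rule summable_comparison_test'[where N = "4 * q"]) (use prob_F in auto)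
  qed (simp add: less_top[symmetric])
  then show ?thesis
  proof eventually_elim
    case (elim s)
    then show ?case
    proof eventually_elim
      case (elim N)
      have "s \<notin> S N n r" if "4 * q \<le> n" "r < 2 ^ n" for n r
        using elim that le_Suc_ex[OF that(1)] by (auto simp: F_def B_def)
      with elim show ?case
        by (auto simp: S_def not_le)
    qed
  qed
qed

text \<open>With \<open>1 / (q + 1) < e\<close>, the levels from \<open>4 * (q + 1)\<close> on have
  frequencies and measures that both lie between 0 and \<open>1 / (q + 1)\<close>, hence differ by
  less than \<open>e\<close>. Finitely many sets remain, and the pointwise law handles
  these.\<close>

lemma AE_uniform_law_of_large_numbers:
  fixes A :: "nat \<Rightarrow> nat \<Rightarrow> 'a set"
  assumes "prob_space M" and A [measurable]: "\<And>n r. A n r \<in> sets M"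
    and small: "\<And>n r. measure M (A n r) \<le> (1/2) ^ n"
  shows "AE s in (\<Pi>\<^sub>M i\<in>(UNIV::nat set). M). \<forall>e>0. \<forall>\<^sub>F N in sequentially.
    \<forall>n. \<forall>r<2 ^ n. \<bar>(\<Sum>i<N. indicator (A n r) (s i)) / real N - measure M (A n r)\<bar> < e"
proof -
  interpret M: prob_space M by fact
  let ?P = "\<Pi>\<^sub>M i\<in>(UNIV::nat set). M"
  have "AE s in ?P. \<forall>n r. (\<lambda>N. (\<Sum>i<N. indicator (A n r) (s i)) / real N) \<longlonglongrightarrow> measure M (A n r)"
    unfolding AE_all_countable
  proof (intro allI)
    fix n r
    show "AE s in ?P. (\<lambda>N. (\<Sum>i<N. indicator (A n r) (s i)) / real N) \<longlonglongrightarrow> measure M (A n r)"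
      using AE_average_tendsto_expectation[OF assms(1), of "indicator (A n r)" 0 1] A
      by (simp add: indicator_simps split: split_indicator)
  qed
  moreover have "AE s in ?P. \<forall>q. \<forall>\<^sub>F N in sequentially. \<forall>n\<ge>4 * Suc q. \<forall>r<2 ^ n.
      real (Suc q) * (\<Sum>i<N. indicator (A n r) (s i)) < real N"
    unfolding AE_all_countable
    by (intro allI AE_eventually_rare_uniformly assms zero_less_Suc)
  ultimately show ?thesis
  proof eventually_elim
    case (elim s)
    show ?case
    proof (intro allI impI)
      fix e :: real assume "e > 0"
      then obtain q where q: "1 / real (Suc q) < e"
        using nat_approx_posE by blast
      let ?Q = "4 * Suc q"
      have "\<forall>\<^sub>F N in sequentially. \<forall>p\<in>(SIGMA n:{..<?Q}. {..<2 ^ n}).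
          \<bar>(\<Sum>i<N. indicator (A (fst p) (snd p)) (s i)) / real N - measure M (A (fst p) (snd p))\<bar> < e"
        using elim(1) \<open>e > 0\<close>
        by (intro eventually_ball_finite) (auto simp: tendsto_iff dist_real_def)
      with elim(2)[rule_format, of q] eventually_gt_at_top[of 0]
      show "\<forall>\<^sub>F N in sequentially. \<forall>n. \<forall>r<2 ^ n.
          \<bar>(\<Sum>i<N. indicator (A n r) (s i)) / real N - measure M (A n r)\<bar> < e"
      proof eventually_elim
        case (elim N)
        show ?case
        proof (intro allI impI)
          fix n r :: nat assume r: "r < 2 ^ n"
          show "\<bar>(\<Sum>i<N. indicator (A n r) (s i)) / real N - measure M (A n r)\<bar> < e"
          proof (cases "n < ?Q")
            case True
            with elim(3) r show ?thesis by (auto dest: bspec[of _ _ "(n, r)"])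
          next
            case False
            let ?S = "\<Sum>i<N. indicator (A n r) (s i) :: real"
            have "real (Suc q) * ?S < real N"
              using elim(1) False r by auto
            then have "?S / real N < 1 / real (Suc q)"
              using elim(2) by (simp add: field_simps del: of_nat_Suc)
            moreover have "0 \<le> ?S / real N"
              by (simp add: sum_nonneg)
            moreover have "measure M (A n r) < e"
            proof -
              have "real (Suc q) \<le> real n"
                using False by simp
              also have "\<dots> \<le> 2 ^ n"
                using of_nat_less_two_power[of n, where 'a = real] by simp
              finally have "real (Suc q) \<le> 2 ^ n" .
              then have "(1/2) ^ n \<le> 1 / real (Suc q)"
                by (simp add: field_simps del: of_nat_Suc)
              with small[of n r] q show ?thesis by linarith
            qed
            ultimately show ?thesis
              using q measure_nonneg[of M "A n r"] by linarith
          qed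
        qed
      qed
    qed
  qed
qed

section \<open>From the McShane to the Henstock-Kurzweil integral\<close>

text \<open>A tagged division, enumerated, is a McShane partition whose tags happen to lie in their
  intervals. Non-integrability can thus be shown for the weaker integral, for which Henstock's lemma
  is at hand.\<close>

lemma has_mcshane_integral_imp_has_integral:
  fixes \<phi> :: "real \<Rightarrow> 'a::banach"
  assumes "has_mcshane_integral \<phi> w"
  shows "(\<phi> has_integral w) {0..1}"
  unfolding has_integral_real
proof (intro allI impI)
  \<comment> \<open>Half of \<open>e\<close> turns the weak inequality of the McShane integral into
    a strict one.\<close>
  fix e :: real assume "e > 0"
  then obtain \<delta> where pos: "\<forall>x\<in>{0..1}. \<delta> x > 0" and
    \<delta>: "\<And>n a b t. mcshane_partition n a b t \<Longrightarrow> subordinate \<delta> n a b t \<Longrightarrow>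
           norm (w - (\<Sum>i<n. (b i - a i) *\<^sub>R \<phi> (t i))) \<le> e / 2"
    using assms[unfolded has_mcshane_integral_def, rule_format, of "e / 2"] by auto
  define \<gamma> where "\<gamma> x = ball x (if x \<in> {0..1} then \<delta> x else 1)" for x
  show "\<exists>\<gamma>. gauge \<gamma> \<and> (\<forall>p. p tagged_division_of {0..1} \<and> \<gamma> fine p \<longrightarrow>
           norm ((\<Sum>(x, K)\<in>p. measure lborel K *\<^sub>R \<phi> x) - w) < e)"
  proof (intro exI conjI allI impI)
    show "gauge \<gamma>"
      using pos by (auto simp: gauge_def \<gamma>_def)
    fix p assume "p tagged_division_of {0..1} \<and> \<gamma> fine p"
    then have p: "p tagged_division_of {0..1}" and fine: "\<gamma> fine p" by auto
    note tag = tagged_division_ofD[OF p]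
    obtain h where h: "bij_betw h {..<card p} p"
      using ex_bij_betw_nat_finite[OF tag(1)] by (auto simp: atLeast0LessThan)
    define a where "a i = interval_lowerbound (snd (h i))" for i
    define b where "b i = interval_upperbound (snd (h i))" for i
    define t where "t i = fst (h i)" for i
    have h_in: "h i \<in> p" if "i < card p" for i
      using h that by (auto simp: bij_betw_def)
    have ab: "snd (h i) = {a i..b i}" "t i \<in> {a i..b i}" if "i < card p" for i
    proof -
      have in_p: "(t i, snd (h i)) \<in> p"
        using h_in[OF that] by (simp add: t_def)
      from tag(2,4)[OF in_p] show "snd (h i) = {a i..b i}"
        by (force simp: a_def b_def)
      with tag(2)[OF in_p] show "t i \<in> {a i..b i}" by simp
    qed
    have content: "measure lborel (snd (h i)) = b i - a i" if "i < card p" for i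
      using ab[OF that] by simp
    have "mcshane_partition (card p) a b t"
      unfolding mcshane_partition_def
    proof (intro conjI allI impI)
      show "a i \<le> b i" if "i < card p" for i
        using ab[OF that] by simp
      show "t i \<in> {0..1}" if "i < card p" for i
        using tag(2,3)[of "t i" "snd (h i)"] h_in[OF that] by (auto simp: t_def)
      show "disjoint_family_on (\<lambda>i. interior {a i..b i}) {..<card p}"
        unfolding disjoint_family_on_def
      proof (intro ballI impI)
        fix i j assume ij: "i \<in> {..<card p}" "j \<in> {..<card p}" "i \<noteq> j"
        then have "h i \<noteq> h j"
          using h by (auto simp: bij_betw_def inj_on_def)
        then have "interior (snd (h i)) \<inter> interior (snd (h j)) = {}"
          using tag(5)[of "fst (h i)" "snd (h i)" "fst (h j)" "snd (h j)"] h_in ij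
          by (simp add: prod_eq_iff)
        with ab(1) ij show "interior {a i..b i} \<inter> interior {a j..b j} = {}"
          by simp
      qed
      have "(\<Union>i<card p. {a i..b i}) = (\<Union>i<card p. snd (h i))"
        using ab(1) by simp
      also have "\<dots> = \<Union>(snd ` h ` {..<card p})"
        by auto
      also have "h ` {..<card p} = p"
        using h by (simp add: bij_betw_def)
      also have "\<Union>(snd ` p) = {0..1}"
        using tag(6) by force
      finally show "(\<Union>i<card p. {a i..b i}) = {0..1}" .
    qed
    moreover have "subordinate \<delta> (card p) a b t"
      unfolding subordinate_def
    proof (intro allI impI)
      fix i assume i: "i < card p"
      have in_p: "(t i, {a i..b i}) \<in> p"
        using h_in[OF i] ab(1)[OF i] by (metis prod.collapse t_def)
      have "a i \<le> b i" using ab(2)[OF i] by simp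
      moreover have "{a i..b i} \<subseteq> ball (t i) (\<delta> (t i))"
        using fineD[OF fine in_p] tag(2,3)[OF in_p] by (auto simp: \<gamma>_def split: if_splits)
      ultimately have "a i \<in> ball (t i) (\<delta> (t i))" "b i \<in> ball (t i) (\<delta> (t i))"
        by auto
      with \<open>a i \<le> b i\<close> show "t i - \<delta> (t i) \<le> a i \<and> a i \<le> b i \<and> b i \<le> t i + \<delta> (t i)"
        by (auto simp: dist_real_def)
    qed
    ultimately have "norm (w - (\<Sum>i<card p. (b i - a i) *\<^sub>R \<phi> (t i))) \<le> e / 2"
      by (rule \<delta>)
    also have "(\<Sum>i<card p. (b i - a i) *\<^sub>R \<phi> (t i)) = (\<Sum>i<card p. measure lborel (snd (h i)) *\<^sub>R \<phi> (fst (h i)))"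
      by (intro sum.cong) (simp_all add: content t_def)
    also have "\<dots> = (\<Sum>(x, K)\<in>p. measure lborel K *\<^sub>R \<phi> x)"
      using sum.reindex_bij_betw[OF h, of "\<lambda>x. measure lborel (snd x) *\<^sub>R \<phi> (fst x)"]
      by (simp add: case_prod_unfold)
    finally show "norm ((\<Sum>(x, K)\<in>p. measure lborel K *\<^sub>R \<phi> x) - w) < e"
      using \<open>e > 0\<close> by (simp add: norm_minus_commute)
  qed
qed

section \<open>The combs and the Talagrand integral\<close>

text \<open>This lets evaluation at a coordinate pass through finite sums and through vector-valued
  integrals.\<close>

lemma bounded_linear_apply_bcontfun:
  "bounded_linear (\<lambda>f :: 'a::topological_space \<Rightarrow>\<^sub>C 'b::real_normed_vector. apply_bcontfun f x)"
  by (rule bounded_linear_intro[where K = 1])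
     (simp_all add: plus_bcontfun.rep_eq scaleR_bcontfun.rep_eq norm_bounded)

lemma apply_bcontfun_sum:
  "apply_bcontfun (\<Sum>i\<in>A. f i) x = (\<Sum>i\<in>A. apply_bcontfun (f i) x)"
  using linear_sum[OF bounded_linear.linear[OF bounded_linear_apply_bcontfun]] .

text \<open>Half-open, so that the cells of level \<open>n\<close> with \<open>c < 4 ^ n\<close>
  partition \<open>{0..<1}\<close>.\<close>

definition cell :: "nat \<Rightarrow> nat \<Rightarrow> real set" where
  "cell n c = {real c / 4 ^ n..<(real c + 1) / 4 ^ n}"

text \<open>The condition on \<open>r\<close> inside the index set makes the comb empty for an
  offset out of range. Every pair \<open>(n, r)\<close> then gives a coordinate, and
  \<open>prod_decode\<close> can enumerate them all.\<close>

definition comb :: "nat \<Rightarrow> nat \<Rightarrow> real set" where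
  "comb n r = (\<Union>j\<in>{j. j < 2 ^ n \<and> r < 2 ^ n}. cell n (2 ^ n * j + r))"

definition comb_map :: "real \<Rightarrow> nat \<Rightarrow>\<^sub>C real" where
  "comb_map t = Bcontfun (\<lambda>k. indicator (comb (fst (prod_decode k)) (snd (prod_decode k))) t)"

lemma comb_map_apply:
  "apply_bcontfun (comb_map t) k = indicator (comb (fst (prod_decode k)) (snd (prod_decode k))) t"
proof -
  have "(\<lambda>k. indicator (comb (fst (prod_decode k)) (snd (prod_decode k))) t :: real) \<in> bcontfun"
    by (auto simp: bcontfun_def intro!: boundedI[where B = 1] split: split_indicator)
  then show ?thesis
    by (simp add: comb_map_def Bcontfun_inverse)
qed

lemma apply_comb_map_prod_encode:
  "apply_bcontfun (comb_map t) (prod_encode (n, r)) = indicator (comb n r) t"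
  by (simp add: comb_map_apply)

lemma norm_comb_map_le: "norm (comb_map t) \<le> 1"
  by (rule norm_bound) (simp add: comb_map_apply indicator_def)

text \<open>Since \<open>4 ^ n = 2 ^ n * 2 ^ n\<close>, the cell with number
  \<open>2 ^ n * j + r\<close> is the \<open>r\<close>-th one of block \<open>j\<close>.\<close>

lemma cell_subset_dyadic:
  assumes "r < 2 ^ n"
  shows "cell n (2 ^ n * j + r) \<subseteq> {real j / 2 ^ n..real (Suc j) / 2 ^ n}"
proof
  fix t assume t: "t \<in> cell n (2 ^ n * j + r)"
  have four: "(4::real) ^ n = 2 ^ n * 2 ^ n"
    by (simp flip: power_mult_distrib)
  have "real (Suc r) \<le> real (2 ^ n)"
    using assms unfolding of_nat_le_iff by simp
  then have "real r + 1 \<le> 2 ^ n" by simp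
  moreover have "2 ^ n * real j + real r \<le> t * (2 ^ n * 2 ^ n)" "t * (2 ^ n * 2 ^ n) < 2 ^ n * real j + real r + 1"
    using t by (simp_all add: cell_def four field_simps)
  moreover have eqs: "2 ^ n * (t * 2 ^ n) = t * (2 ^ n * 2 ^ n)" "2 ^ n * (real j + 1) = 2 ^ n * real j + 2 ^ n"
    by (simp_all add: algebra_simps)
  ultimately have "2 ^ n * real j \<le> (2::real) ^ n * (t * 2 ^ n)"
      "(2::real) ^ n * (t * 2 ^ n) \<le> 2 ^ n * (real j + 1)"
    unfolding eqs by linarith+
  then have "real j \<le> t * 2 ^ n" "t * 2 ^ n \<le> real j + 1"
    by (simp_all only: mult_le_cancel_left_pos zero_less_power zero_less_numeral)
  then show "t \<in> {real j / 2 ^ n..real (Suc j) / 2 ^ n}"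
    by (simp add: field_simps)
qed

lemma comb_subset: "comb n r \<subseteq> {0..1}"
proof
  fix t assume "t \<in> comb n r"
  then obtain j where j: "j < 2 ^ n" "r < 2 ^ n" "t \<in> cell n (2 ^ n * j + r)"
    by (auto simp: comb_def)
  then have t: "real j / 2 ^ n \<le> t" "t \<le> real (Suc j) / 2 ^ n"
    using cell_subset_dyadic[of r n j] by auto
  have "real (Suc j) \<le> real (2 ^ n)"
    using j unfolding of_nat_le_iff by simp
  then have "real (Suc j) / 2 ^ n \<le> 1"
    by simp
  moreover have "0 \<le> real j / 2 ^ n" by simp
  ultimately show "t \<in> {0..1}"
    using t unfolding atLeastAtMost_iff by linarith
qed

lemma cell_lmeasurable [simp]: "cell n c \<in> lmeasurable"
  unfolding cell_def by (rule bounded_set_imp_lmeasurable) (auto intro: bounded_subset[OF bounded_closed_interval])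

lemma measure_cell: "measure lebesgue (cell n c) = 1 / 4 ^ n"
  by (simp add: cell_def field_simps)

lemma comb_lmeasurable [simp]: "comb n r \<in> lmeasurable"
  by (auto simp: comb_def intro!: fmeasurable.finite_UN)

text \<open>At most \<open>2 ^ n\<close> cells of length \<open>1 / 4 ^ n\<close> each; the
  inequality also covers the empty combs.\<close>

lemma measure_comb_le: "measure lebesgue (comb n r) \<le> (1/2) ^ n"
proof -
  let ?J = "{j. j < (2::nat) ^ n \<and> r < (2::nat) ^ n}"
  have "card ?J \<le> card {..<(2::nat) ^ n}"
    by (intro card_mono) auto
  then have card: "real (card ?J) \<le> 2 ^ n"
    by (metis card_lessThan of_nat_le_iff of_nat_numeral of_nat_power)
  have "measure lebesgue (comb n r) \<le> (\<Sum>j\<in>?J. measure lebesgue (cell n (2 ^ n * j + r)))"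
    unfolding comb_def by (intro measure_UNION_le) (auto simp: fmeasurableD)
  also have "\<dots> = real (card ?J) * (1 / 4 ^ n)"
    by (simp add: measure_cell)
  also have "\<dots> \<le> 2 ^ n * (1 / 4 ^ n)"
    using card by (intro mult_right_mono) auto
  also have "(4::real) ^ n = 2 ^ n * 2 ^ n"
    by (simp flip: power_mult_distrib)
  finally show ?thesis
    by (simp add: power_divide)
qed

text \<open>The norm is the supremum over the coordinates, so norm convergence of the averages is
  the law of large numbers holding uniformly over the combs.\<close>

lemma talagrand_integrable_comb_map: "talagrand_integrable comb_map"
proof -
  let ?L = "lebesgue_on {0..1::real}"
  let ?idx = prod_decode
  have prob: "prob_space ?L"
    by (rule prob_spaceI) (simp add: emeasure_restrict_space)
  have sets: "comb n r \<in> sets ?L" for n r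
    using comb_subset[of n r] by (simp add: sets_restrict_space_iff fmeasurableD)
  have measure_eq: "measure ?L (comb n r) = measure lebesgue (comb n r)" for n r
    using comb_subset[of n r] by (simp add: measure_restrict_space)
  \<comment> \<open>The integral must be the coordinatewise expectation.\<close>
  define w where "w = Bcontfun (\<lambda>k. measure ?L (comb (fst (?idx k)) (snd (?idx k))))"
  have "(\<lambda>k. measure ?L (comb (fst (?idx k)) (snd (?idx k)))) \<in> bcontfun"
    using prob_space.prob_le_1[OF prob]
    by (auto simp: bcontfun_def intro!: boundedI[where B = 1])
  then have w: "apply_bcontfun w k = measure ?L (comb (fst (?idx k)) (snd (?idx k)))" for k
    by (simp add: w_def Bcontfun_inverse)
  have "AE s in (\<Pi>\<^sub>M i\<in>(UNIV::nat set). ?L). \<forall>e>0. \<forall>\<^sub>F N in sequentially. \<forall>n. \<forall>r<2 ^ n.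
      \<bar>(\<Sum>i<N. indicator (comb n r) (s i)) / real N - measure ?L (comb n r)\<bar> < e"
    by (rule AE_uniform_law_of_large_numbers) (simp_all add: prob sets measure_eq measure_comb_le)
  then have "has_talagrand_integral comb_map w"
    unfolding has_talagrand_integral_def
  proof eventually_elim
    case (elim s)
    show ?case
    proof (rule tendstoI)
      \<comment> \<open>A supremum of numbers below \<open>e / 2\<close> is only known to be at most
        \<open>e / 2\<close>, hence the halving.\<close>
      fix e :: real assume "e > 0"
      then have "\<forall>\<^sub>F N in sequentially. \<forall>n. \<forall>r<2 ^ n.
          \<bar>(\<Sum>i<N. indicator (comb n r) (s i)) / real N - measure ?L (comb n r)\<bar> < e / 2"
        using elim[rule_format, of "e / 2"] by (simp only: half_gt_zero)
      then show "\<forall>\<^sub>F N in sequentially. dist ((1 / real N) *\<^sub>R (\<Sum>i<N. comb_map (s i))) w < e"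
      proof eventually_elim
        case (elim N)
        let ?avg = "(1 / real N) *\<^sub>R (\<Sum>i<N. comb_map (s i))"
        have "norm (apply_bcontfun (?avg - w) k) \<le> e / 2" for k
        proof -
          obtain n r where k: "?idx k = (n, r)" by fastforce
          have "apply_bcontfun ?avg k = (\<Sum>i<N. indicator (comb n r) (s i)) / real N"
            by (simp add: scaleR_bcontfun.rep_eq apply_bcontfun_sum comb_map_apply k del: scaleR_sum_right)
          then have "apply_bcontfun (?avg - w) k
              = (\<Sum>i<N. indicator (comb n r) (s i)) / real N - measure ?L (comb n r)"
            by (simp add: minus_bcontfun.rep_eq w k)
          moreover have "comb n r = {}" if "\<not> r < 2 ^ n"
            using that by (simp add: comb_def)
          ultimately show ?thesis
            using elim \<open>e > 0\<close> by (cases "r < 2 ^ n") (auto intro: less_imp_le)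
        qed
        then have "norm (?avg - w) \<le> e / 2"
          by (rule norm_bound)
        with \<open>e > 0\<close> show ?case
          by (simp add: dist_norm)
      qed
    qed
  qed
  then show ?thesis
    by (auto simp: talagrand_integrable_def)
qed

section \<open>Failure of McShane integrability\<close>

lemma cell_cover:
  assumes "t \<in> {0..<1}"
  obtains c where "c < 4 ^ n" "t \<in> cell n c"
proof -
  have "0 \<le> t * 4 ^ n" "t * 4 ^ n < 4 ^ n" using assms by auto
  then have "nat \<lfloor>t * 4 ^ n\<rfloor> < 4 ^ n" "t \<in> cell n (nat \<lfloor>t * 4 ^ n\<rfloor>)"
    by (auto simp: cell_def nat_less_iff floor_less_iff field_simps) linarith+
  then show ?thesis by (rule that)
qed

text \<open>The cells that meet \<open>D\<close> cover it. Outer measure is used because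
  \<open>D\<close> will come from an arbitrary gauge and need not be measurable.\<close>

lemma outer_measure_le_card_cells:
  assumes "D \<subseteq> {0..<1}"
  shows "outer_measure_of lebesgue D \<le> ennreal (card {c. c < 4 ^ n \<and> cell n c \<inter> D \<noteq> {}} / 4 ^ n)"
proof -
  let ?C = "{c. c < (4::nat) ^ n \<and> cell n c \<inter> D \<noteq> {}}"
  have fin: "finite ?C" by auto
  have meas: "(\<Union>c\<in>?C. cell n c) \<in> lmeasurable"
    using fin by (auto intro!: fmeasurable.finite_UN)
  have "D \<subseteq> (\<Union>c\<in>?C. cell n c)"
  proof
    fix t assume "t \<in> D"
    moreover then obtain c where "c < 4 ^ n" "t \<in> cell n c"
      using assms cell_cover by blast
    ultimately show "t \<in> (\<Union>c\<in>?C. cell n c)" by blast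
  qed
  then have "outer_measure_of lebesgue D \<le> outer_measure_of lebesgue (\<Union>c\<in>?C. cell n c)"
    by (rule outer_measure_of_mono)
  also have "\<dots> = ennreal (measure lebesgue (\<Union>c\<in>?C. cell n c))"
    using meas by (simp add: fmeasurableD emeasure_eq_measure2)
  also have "\<dots> \<le> ennreal (\<Sum>c\<in>?C. measure lebesgue (cell n c))"
    by (intro ennreal_leI measure_UNION_le fin) (simp add: fmeasurableD)
  also have "(\<Sum>c\<in>?C. measure lebesgue (cell n c)) = card ?C / 4 ^ n"
    by (simp add: measure_cell)
  finally show ?thesis .
qed

text \<open>Averaging over \<open>r\<close>: the combs of level \<open>n\<close> partition the cells.\<close>

lemma exists_comb_many_teeth:
  assumes "D \<subseteq> {0..<1}" "outer_measure_of lebesgue D > ennreal a" "a \<ge> 0"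
  obtains (many) r where "r < 2 ^ n"
    "real (card {j. j < 2 ^ n \<and> cell n (2 ^ n * j + r) \<inter> D \<noteq> {}}) > a * 2 ^ n"
proof (rule ccontr)
  let ?C = "{c. c < (4::nat) ^ n \<and> cell n c \<inter> D \<noteq> {}}"
  let ?J = "\<lambda>r. {j. j < (2::nat) ^ n \<and> cell n (2 ^ n * j + r) \<inter> D \<noteq> {}}"
  assume "\<not> thesis"
  then have few: "real (card (?J r)) \<le> a * 2 ^ n" if "r < 2 ^ n" for r
    using many[OF that] by (meson not_le)
  \<comment> \<open>Division of the cell number by \<open>2 ^ n\<close> gives the block as quotient
    and the offset as remainder.\<close>
  have "?C \<subseteq> (\<Union>r<2 ^ n. (\<lambda>j. 2 ^ n * j + r) ` ?J r)"
  proof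
    fix c assume c: "c \<in> ?C"
    then have "c < 2 ^ n * 2 ^ n"
      by (simp flip: power_mult_distrib)
    then have "c div 2 ^ n < 2 ^ n"
      by (simp add: less_mult_imp_div_less)
    with c show "c \<in> (\<Union>r<2 ^ n. (\<lambda>j. 2 ^ n * j + r) ` ?J r)"
      by (intro UN_I[of "c mod 2 ^ n"] image_eqI[of _ _ "c div 2 ^ n"]) auto
  qed
  then have "card ?C \<le> card (\<Union>r<(2::nat) ^ n. (\<lambda>j. 2 ^ n * j + r) ` ?J r)"
    by (intro card_mono) auto
  also have "\<dots> \<le> (\<Sum>r<2 ^ n. card ((\<lambda>j. 2 ^ n * j + r) ` ?J r))"
    by (intro card_UN_le) auto
  also have "\<dots> \<le> (\<Sum>r<2 ^ n. card (?J r))"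
    by (intro sum_mono card_image_le) auto
  finally have "real (card ?C) \<le> (\<Sum>r<2 ^ n. real (card (?J r)))"
    unfolding of_nat_sum[symmetric] by (rule of_nat_mono)
  also have "\<dots> \<le> (\<Sum>r<(2::nat) ^ n. a * 2 ^ n)"
    by (intro sum_mono few) auto
  also have "\<dots> = a * 4 ^ n"
    by (simp flip: power_mult_distrib)
  finally have "card ?C / 4 ^ n \<le> a"
    by (simp add: field_simps)
  with outer_measure_le_card_cells[OF assms(1), of n] assms(2) show False
    by (meson ennreal_leI not_le order_trans)
qed

text \<open>Adjacent blocks are combined one by one. With \<open>m = 2 ^ n\<close> it will bound the
  integrals over selected blocks by the measure of a whole comb.\<close>

lemma sum_integral_dyadic:
  fixes f :: "real \<Rightarrow> real"
  assumes "f integrable_on {0..1}" "m \<le> 2 ^ n"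
  shows "(\<Sum>j<m. integral {real j / 2 ^ n..real (Suc j) / 2 ^ n} f) = integral {0..real m / 2 ^ n} f"
  using assms(2)
proof (induction m)
  case (Suc m)
  have "real (Suc m) \<le> real (2 ^ n)"
    using Suc.prems unfolding of_nat_le_iff .
  then have "f integrable_on {0..real (Suc m) / 2 ^ n}"
    by (intro integrable_subinterval_real[OF assms(1)]) auto
  then have "integral {0..real m / 2 ^ n} f + integral {real m / 2 ^ n..real (Suc m) / 2 ^ n} f
      = integral {0..real (Suc m) / 2 ^ n} f"
    by (intro Henstock_Kurzweil_Integration.integral_combine) (auto simp: divide_right_mono)
  with Suc show ?case by simp
qed simp


text \<open>In the coordinate of a suitable comb, the tagged sum over selected blocks exceeds 3/4
  while the integrals over them add up to at most 1/4. The gap of more than 1/2 contradicts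
  Henstock's lemma with tolerance 1/4.\<close>

lemma not_mcshane_integrable_comb_map: "\<not> mcshane_integrable comb_map"
proof
  assume "mcshane_integrable comb_map"
  then obtain w where w: "(comb_map has_integral w) (cbox 0 1)"
    by (auto simp: mcshane_integrable_def dest: has_mcshane_integral_imp_has_integral)
  then have int: "comb_map integrable_on cbox 0 1" and w_eq: "integral (cbox 0 1) comb_map = w"
    by (auto simp: has_integral_iff)
  obtain \<gamma> where "gauge \<gamma>" and \<gamma>:
    "\<And>p. p tagged_division_of cbox 0 1 \<Longrightarrow> \<gamma> fine p \<Longrightarrow>
       norm ((\<Sum>(x, K)\<in>p. measure lborel K *\<^sub>R comb_map x) - integral (cbox 0 1) comb_map) < 1/4"
    using w[unfolded has_integral, rule_format, of "1/4"] unfolding w_eq by auto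
  \<comment> \<open>The radius is the length of a block of level \<open>i + 2\<close>: a block
    containing a point of \<open>D i\<close> may be tagged by that point.\<close>
  define D where "D i = {t\<in>{0..<1}. cball t ((1/2) ^ (i + 2)) \<subseteq> \<gamma> t}" for i
  have "incseq D"
  proof (rule incseq_SucI)
    fix i
    have "cball t ((1/2) ^ (Suc i + 2)) \<subseteq> cball t ((1/2) ^ (i + 2))" for t :: real
      by (intro subset_cball power_decreasing) auto
    then show "D i \<le> D (Suc i)" by (auto simp: D_def)
  qed
  have "(\<Union>i. D i) = {0..<1}"
  proof (intro equalityI subsetI)
    fix t :: real assume t: "t \<in> {0..<1}"
    obtain e where e: "e > 0" "cball t e \<subseteq> \<gamma> t"
      using gaugeD[OF \<open>gauge \<gamma>\<close>, of t] open_contains_cball by blast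
    obtain i where "(1/2) ^ i < e"
      using real_arch_pow_inv[OF \<open>e > 0\<close>, of "1/2"] by auto
    moreover have "(1/2::real) ^ (i + 2) \<le> (1/2) ^ i"
      by (rule power_decreasing) auto
    ultimately have "cball t ((1/2) ^ (i + 2)) \<subseteq> cball t e"
      by (intro subset_cball) linarith
    with e t show "t \<in> (\<Union>i. D i)" by (auto simp: D_def)
  qed (auto simp: D_def)
  \<comment> \<open>Outer measure is continuous along increasing sequences even of non-measurable
    sets.\<close>
  then have "(SUP i. outer_measure_of lebesgue (D i)) = 1"
    using SUP_outer_measure_of_incseq[of D lebesgue] \<open>incseq D\<close> by simp
  then have "ennreal (3/4) < (SUP i. outer_measure_of lebesgue (D i))"
    by (simp add: ennreal_less_one_iff)
  then obtain i where i: "ennreal (3/4) < outer_measure_of lebesgue (D i)"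
    by (auto simp: less_SUP_iff)
  \<comment> \<open>Besides matching the radius in \<open>D i\<close>, this gives
    \<open>n \<ge> 2\<close>, so every comb of level \<open>n\<close> has measure at most
    1/4.\<close>
  define n where "n = i + 2"
  have "D i \<subseteq> {0..<1}" by (auto simp: D_def)
  then obtain r where r: "r < 2 ^ n"
    and many: "real (card {j. j < 2 ^ n \<and> cell n (2 ^ n * j + r) \<inter> D i \<noteq> {}}) > 3/4 * 2 ^ n"
    by (rule exists_comb_many_teeth[OF _ i]) simp
  define J where "J = {j. j < 2 ^ n \<and> cell n (2 ^ n * j + r) \<inter> D i \<noteq> {}}"
  have J: "finite J" "J \<subseteq> {..<2 ^ n}" by (auto simp: J_def)
  have "\<forall>j\<in>J. \<exists>t. t \<in> cell n (2 ^ n * j + r) \<inter> D i"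
    by (auto simp: J_def)
  \<comment> \<open>The tags lie both in the comb, where the coordinate is 1, and in
    \<open>D i\<close>, where the gauge admits the whole block.\<close>
  then obtain \<tau> where \<tau>: "\<And>j. j \<in> J \<Longrightarrow> \<tau> j \<in> cell n (2 ^ n * j + r) \<inter> D i"
    by metis
  define I where "I j = {real j / 2 ^ n..real (Suc j) / 2 ^ n}" for j
  have \<tau>_I: "\<tau> j \<in> I j" if "j \<in> J" for j
    using \<tau>[OF that] cell_subset_dyadic[OF r, of j] by (auto simp: I_def)
  have \<tau>_comb: "\<tau> j \<in> comb n r" if "j \<in> J" for j
    using \<tau>[OF that] r J that by (auto simp: comb_def)
  have I_sub: "I j \<subseteq> {0..1}" if "j < 2 ^ n" for j
  proof -
    have "real (Suc j) \<le> real (2 ^ n)"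
      using that unfolding of_nat_le_iff by simp
    then have "real (Suc j) / 2 ^ n \<le> 1"
      by simp
    moreover have "0 \<le> real j / 2 ^ n" by simp
    ultimately show ?thesis
      unfolding I_def by (simp only: atLeastatMost_subset_iff) simp
  qed
  have disj: "interior (I j) \<inter> interior (I j') = {}" if "j < j'" for j j'
  proof -
    have "real (Suc j) / 2 ^ n \<le> real j' / 2 ^ n"
      using that by (intro divide_right_mono) auto
    then show ?thesis
      by (auto simp: I_def)
  qed
  have inj: "inj_on (\<lambda>j. (\<tau> j, I j)) J"
    by (rule inj_onI) (simp add: I_def Icc_eq_Icc divide_right_mono)
  define p where "p = (\<lambda>j. (\<tau> j, I j)) ` J"
  have "p tagged_partial_division_of cbox 0 1"
    unfolding tagged_partial_division_of_def
  proof (intro conjI allI impI)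
    show "finite p" using J by (simp add: p_def)
    show "x \<in> K" "K \<subseteq> cbox 0 1" "\<exists>a b. K = cbox a b" if "(x, K) \<in> p" for x K
    proof -
      obtain j where j: "j \<in> J" "x = \<tau> j" "K = I j"
        using \<open>(x, K) \<in> p\<close> unfolding p_def by blast
      show "x \<in> K"
        using \<tau>_I[OF j(1)] unfolding j(2,3) .
      show "K \<subseteq> cbox 0 1"
        using I_sub j J unfolding box_real by blast
      show "\<exists>a b. K = cbox a b"
        unfolding j(3) I_def cbox_interval[symmetric] by blast
    qed
    fix x1 K1 x2 K2
    assume "(x1, K1) \<in> p \<and> (x2, K2) \<in> p \<and> (x1, K1) \<noteq> (x2, K2)"
    then obtain j j' where "K1 = I j" "K2 = I j'" "j \<noteq> j'"
      by (auto simp: p_def)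
    then show "interior K1 \<inter> interior K2 = {}"
      using disj[of j j'] disj[of j' j] by (auto simp: neq_iff Int_commute)
  qed
  moreover have "\<gamma> fine p"
  proof (rule fineI)
    fix x K assume "(x, K) \<in> p"
    then obtain j where j: "j \<in> J" "x = \<tau> j" "K = I j" by (auto simp: p_def)
    have "K \<subseteq> cball x ((1/2) ^ n)"
    proof
      fix y assume "y \<in> K"
      with \<tau>_I[OF j(1)] j have "\<bar>x - y\<bar> \<le> real (Suc j) / 2 ^ n - real j / 2 ^ n"
        by (auto simp: I_def)
      then show "y \<in> cball x ((1/2) ^ n)"
        by (simp add: dist_real_def power_divide add_divide_distrib)
    qed
    also have "\<dots> \<subseteq> \<gamma> x"
      using \<tau>[OF j(1)] j by (simp add: D_def n_def)
    finally show "K \<subseteq> \<gamma> x" .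
  qed
  \<comment> \<open>Henstock's lemma carries the tolerance over to partial divisions, so the blocks
    without a tag in \<open>D i\<close> can be left out.\<close>
  ultimately have "norm (\<Sum>(x, K)\<in>p. measure lborel K *\<^sub>R comb_map x - integral K comb_map) \<le> 1/4"
    by (intro Henstock_lemma_part1[OF int _ \<open>gauge \<gamma>\<close> \<gamma>]) auto
  also have "(\<Sum>(x, K)\<in>p. measure lborel K *\<^sub>R comb_map x - integral K comb_map)
      = (\<Sum>j\<in>J. (1 / 2 ^ n) *\<^sub>R comb_map (\<tau> j) - integral (I j) comb_map)" (is "_ = ?s")
    unfolding p_def by (subst sum.reindex[OF inj]) (simp add: I_def divide_right_mono add_divide_distrib)
  finally have norm: "norm ?s \<le> 1/4" .
  let ?k = "prod_encode (n, r)"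
  let ?f = "indicator (comb n r) :: real \<Rightarrow> real"
  have integral: "apply_bcontfun (integral (I j) comb_map) ?k = integral (I j) ?f" if "j \<in> J" for j
  proof -
    have "comb_map integrable_on I j"
      using integrable_subinterval_real[OF int[unfolded box_real]] I_sub that J
      unfolding I_def by blast
    from integral_linear[OF this bounded_linear_apply_bcontfun[of ?k]]
    show ?thesis unfolding o_def apply_comb_map_prod_encode by (rule sym)
  qed
  have f_int: "?f integrable_on {0..1}"
    by (simp add: integrable_on_indicator fmeasurable_Int_fmeasurable fmeasurableD)
  \<comment> \<open>The omitted blocks contribute non-negative integrals, so adding them bounds the
    sum by the measure of the comb.\<close>
  have "(\<Sum>j\<in>J. integral (I j) ?f) \<le> (\<Sum>j<2 ^ n. integral (I j) ?f)"
  proof (rule sum_mono2)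
    fix j assume "j \<in> {..<2 ^ n} - J"
    then have "?f integrable_on I j"
      using integrable_subinterval_real[OF f_int] I_sub unfolding I_def by blast
    then show "0 \<le> integral (I j) ?f"
      by (rule Henstock_Kurzweil_Integration.integral_nonneg) simp
  qed (use J in auto)
  also have "\<dots> = integral {0..1} ?f"
    using sum_integral_dyadic[OF f_int, of "2 ^ n" n] by (simp add: I_def)
  also have "\<dots> = measure lebesgue (comb n r)"
    using comb_subset[of n r] by (simp add: integral_indicator Int_absorb2)
  also have "\<dots> \<le> (1/2) ^ n"
    by (rule measure_comb_le)
  also have "\<dots> \<le> (1/2) ^ 2"
    unfolding n_def by (rule power_decreasing) auto
  finally have small: "(\<Sum>j\<in>J. integral (I j) ?f) \<le> 1/4"
    by (simp add: power2_eq_square)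
  have "apply_bcontfun ?s ?k = (\<Sum>j\<in>J. 1 / 2 ^ n - integral (I j) ?f)"
    by (simp add: apply_bcontfun_sum minus_bcontfun.rep_eq scaleR_bcontfun.rep_eq integral apply_comb_map_prod_encode \<tau>_comb)
  also have "\<dots> = card J / 2 ^ n - (\<Sum>j\<in>J. integral (I j) ?f)"
    by (simp add: sum_subtractf)
  finally have eq: "apply_bcontfun ?s ?k = card J / 2 ^ n - (\<Sum>j\<in>J. integral (I j) ?f)" .
  have "3/4 < card J / 2 ^ n"
    using many unfolding J_def[symmetric] by (simp add: field_simps)
  then have "3/4 - 1/4 < card J / 2 ^ n - (\<Sum>j\<in>J. integral (I j) ?f)"
    using small by (rule diff_strict_right_mono[THEN less_le_trans, OF _ diff_left_mono])
  also have "\<dots> \<le> norm ?s"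
    unfolding eq[symmetric] using norm_bounded[of ?s ?k] unfolding real_norm_def by (rule abs_le_D1)
  also note norm
  finally show False by simp
qed

theorem mainTheorem5:
  shows "\<exists>\<phi> :: real \<Rightarrow> (nat \<Rightarrow>\<^sub>C real).
           bounded (\<phi> ` {0..1}) \<and> talagrand_integrable \<phi> \<and> \<not> mcshane_integrable \<phi>"
proof (intro exI conjI)
  show "bounded (comb_map ` {0..1})"
    using norm_comb_map_le by (intro boundedI[where B = 1]) auto
qed (fact talagrand_integrable_comb_map not_mcshane_integrable_comb_map)+

end
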